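(* Consider the averaged conservative Keplerian spin-spin model (coupling parameter $\chi=1$) in the $(1:1,1:1)$ resonance, linearized at the critical point $(\varphi_1,\varphi_2,J_1,J_2)=(0,0,0,0)$, that is, the linear system in $(\xi_1,\xi_2,J_1,J_2)$ $$\dot\xi_1=\frac{2}{C_1}J_1,\qquad \dot\xi_2=\frac{2}{C_2}J_2,$$ $$\dot J_1=-(K_1+K_2+2K_3+K_4+K_5)\,\xi_1-(K_4-K_5)\,\xi_2,$$ $$\dot J_2=-(L_4-L_5)\,\xi_1-(L_1+L_2+2L_3+L_4+L_5)\,\xi_2,$$ where the constants are $$K_1=\frac{3d_1GM_2}{2a^3}\Bigl(1-\frac52e^2\Bigr),\quad L_1=\frac{3d_2GM_1}{2a^3}\Bigl(1-\frac52e^2\Bigr),$$ $$K_2=\Bigl(\frac{75d_1GM_2q_1}{56a^5M_1}+\frac{15d_1Gq_2}{8a^5}\Bigr)(1+e^2),\quad L_2=\Bigl(\frac{75d_2GM_1q_2}{56a^5M_2}+\frac{15d_2Gq_1}{8a^5}\Bigr)(1+e^2),$$ $$K_3=\frac{75d_1^2GM_2}{16a^5M_1}(1-11e^2),\quad L_3=\frac{75d_2^2GM_1}{16a^5M_2}(1-11e^2),$$ $$K_4=L_4=\frac{105d_1d_2G}{16a^5}(1-11e^2),\quad K_5=L_5=\frac{9d_1d_2G}{16a^5}+\frac{45d_1d_2e^2G}{16a^5}.$$ If $e<\frac{1}{\sqrt{11}}$, then the eigenvalues of this linear system are purely imaginary.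
   Context: Two homogeneous rigid ellipsoids $\mathcal E_1,\mathcal E_2$ with masses $M_1,M_2$ and principal moments of inertia $A_j\le B_j\le C_j$ ($j=1,2$) move on a Keplerian orbit with semimajor axis $a$ and eccentricity $e$; the spin axis of each body is perpendicular to the orbital plane and has the direction of its shortest physical axis. Units are normalized so that $M_1+M_2=1$, $C_1+C_2=1$ and the orbital period is $2\pi$, so that the gravitational constant is $G=a^3$. Put $d_j=B_j-A_j$ and $q_j=2C_j-B_j-A_j$; one has $0\le d_j\le C_j\le 1$ and $d_j\le q_j\le 2C_j\le 2$. If $\theta_j$ are the rotation angles and $t$ is time, the resonant angles for the $(1:1,1:1)$ resonance are $\varphi_j=2(\theta_j-t)$. Expanding the potential to second order in $e$ and keeping only the terms that do not vanish after averaging over time, the conservative equations for $\chi=1$ are $\dot\varphi_1=\frac{2}{C_1}J_1$, $\dot\varphi_2=\frac{2}{C_2}J_2$, $\dot J_1=-(K_1+K_2)\sin\varphi_1-K_3\sin2\varphi_1-K_4\sin(\varphi_1+\varphi_2)-K_5\sin(\varphi_1-\varphi_2)$, $\dot J_2=-(L_1+L_2)\sin\varphi_2-L_3\sin2\varphi_2-L_4\sin(\varphi_1+\varphi_2)+L_5\sin(\varphi_1-\varphi_2)$; $\xi_j$ denotes the small displacement of $\varphi_j$ from the critical point. *)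

theory Defs
  imports "HOL-Analysis.Analysis" "Jordan_Normal_Form.Char_Poly"
begin

text \<open>
  The averaged conservative Keplerian spin-spin model with coupling parameter 1 in the
  (1:1, 1:1) resonance. A state is \<open>(\<phi>1, \<phi>2, J1, J2)\<close>, with resonant angles
  \<open>\<phi>j = 2 (\<theta>j - t)\<close> and spin variables \<open>Jj\<close>.
\<close>

definition averaged_field ::
  "real \<Rightarrow> real \<Rightarrow> real \<Rightarrow> real \<Rightarrow> real \<Rightarrow> real \<Rightarrow> real \<Rightarrow> real \<Rightarrow> real \<Rightarrow> real \<Rightarrow> real \<Rightarrow> real \<Rightarrow>
   real \<times> real \<times> real \<times> real \<Rightarrow> real \<times> real \<times> real \<times> real" where
  "averaged_field C1 C2 K1 K2 K3 K4 K5 L1 L2 L3 L4 L5 = (\<lambda>(\<phi>1, \<phi>2, J1, J2).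
     (2 / C1 * J1,
      2 / C2 * J2,
      - (K1 + K2) * sin \<phi>1 - K3 * sin (2 * \<phi>1) - K4 * sin (\<phi>1 + \<phi>2) - K5 * sin (\<phi>1 - \<phi>2),
      - (L1 + L2) * sin \<phi>2 - L3 * sin (2 * \<phi>2) - L4 * sin (\<phi>1 + \<phi>2) + L5 * sin (\<phi>1 - \<phi>2)))"

text \<open>
  The coefficient matrix of the linearization at the origin, in the coordinates
  \<open>(\<xi>1, \<xi>2, J1, J2)\<close>.
\<close>

definition linearized_matrix ::
  "real \<Rightarrow> real \<Rightarrow> real \<Rightarrow> real \<Rightarrow> real \<Rightarrow> real \<Rightarrow> real \<Rightarrow> real \<Rightarrow> real \<Rightarrow> real \<Rightarrow> real \<Rightarrow> real \<Rightarrow> real mat" where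
  "linearized_matrix C1 C2 K1 K2 K3 K4 K5 L1 L2 L3 L4 L5 = mat_of_rows_list 4
     [[0, 0, 2 / C1, 0],
      [0, 0, 0, 2 / C2],
      [- (K1 + K2 + 2 * K3 + K4 + K5), - (K4 - K5), 0, 0],
      [- (L4 - L5), - (L1 + L2 + 2 * L3 + L4 + L5), 0, 0]]"

lemma averaged_field_critical_point:
  "averaged_field C1 C2 K1 K2 K3 K4 K5 L1 L2 L3 L4 L5 (0, 0, 0, 0) = (0, 0, 0, 0)"
  by (simp add: averaged_field_def)

lemma averaged_field_has_derivative:
  assumes "C1 \<noteq> 0" and "C2 \<noteq> 0"
  shows "(averaged_field C1 C2 K1 K2 K3 K4 K5 L1 L2 L3 L4 L5 has_derivative
     (\<lambda>(\<xi>1, \<xi>2, J1, J2).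
       let w = linearized_matrix C1 C2 K1 K2 K3 K4 K5 L1 L2 L3 L4 L5 *\<^sub>v vec_of_list [\<xi>1, \<xi>2, J1, J2]
       in (vec_index w 0, vec_index w 1, vec_index w 2, vec_index w 3)))
   (at (0, 0, 0, 0))"
  using assms unfolding averaged_field_def linearized_matrix_def Let_def case_prod_beta
  by (auto intro!: derivative_eq_intros ext
      simp: mat_of_rows_list_def scalar_prod_def eval_nat_numeral algebra_simps
        vec_of_list_index)

end

theory Submission
  imports Defs
begin

text \<open>
  Eliminating \<open>J\<close> from the eigenvalue equations gives \<open>\<mu>\<^sup>2 C x = - 2 S x\<close> for the vector
  \<open>x = (\<xi>1, \<xi>2)\<close>, where \<open>C = diag(C1, C2)\<close> is positive definite and \<open>S\<close> is symmetric because
  \<open>K4 = L4\<close> and \<open>K5 = L5\<close>. The Hermitian form of \<open>S\<close> is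
  \<open>(K1 + K2 + 2 K3) \<bar>\<xi>1\<bar>\<^sup>2 + (L1 + L2 + 2 L3) \<bar>\<xi>2\<bar>\<^sup>2 + K4 \<bar>\<xi>1 + \<xi>2\<bar>\<^sup>2 + K5 \<bar>\<xi>1 - \<xi>2\<bar>\<^sup>2\<close>,
  and all its coefficients are nonnegative for \<open>11 e\<^sup>2 < 1\<close>. Pairing with \<open>x\<close> shows that
  \<open>\<mu>\<^sup>2\<close> is a nonpositive real number.
\<close>

lemma linearized_matrix_eigenvalueE:
  assumes ev: "eigenvalue (map_mat complex_of_real
      (linearized_matrix C1 C2 K1 K2 K3 K4 K5 L1 L2 L3 L4 L5)) \<mu>"
    and C: "C1 \<noteq> 0" "C2 \<noteq> 0"
  obtains x y :: complex where "x \<noteq> 0 \<or> y \<noteq> 0"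
    and "\<mu>\<^sup>2 * of_real C1 * x = - 2 * (of_real (K1 + K2 + 2 * K3 + K4 + K5) * x + of_real (K4 - K5) * y)"
    and "\<mu>\<^sup>2 * of_real C2 * y = - 2 * (of_real (L4 - L5) * x + of_real (L1 + L2 + 2 * L3 + L4 + L5) * y)"
proof -
  let ?A = "map_mat complex_of_real (linearized_matrix C1 C2 K1 K2 K3 K4 K5 L1 L2 L3 L4 L5)"
  have "dim_row ?A = 4"
    by (simp add: linearized_matrix_def mat_of_rows_list_def)
  then obtain v where v: "v \<in> carrier_vec 4" "v \<noteq> 0\<^sub>v 4" "?A *\<^sub>v v = \<mu> \<cdot>\<^sub>v v"
    using ev unfolding eigenvalue_def eigenvector_def by metis
  have row: "vec_index (?A *\<^sub>v v) i = \<mu> * vec_index v i" if "i < 4" for i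
    using v that by simp
  have e0: "of_real (2 / C1) * vec_index v 2 = \<mu> * vec_index v 0"
    and e1: "of_real (2 / C2) * vec_index v 3 = \<mu> * vec_index v 1"
    and e2: "- of_real (K1 + K2 + 2 * K3 + K4 + K5) * vec_index v 0 - of_real (K4 - K5) * vec_index v 1 = \<mu> * vec_index v 2"
    and e3: "- of_real (L4 - L5) * vec_index v 0 - of_real (L1 + L2 + 2 * L3 + L4 + L5) * vec_index v 1 = \<mu> * vec_index v 3"
    using row[of 0] row[of 1] row[of 2] row[of 3] v(1)
    by (simp_all add: linearized_matrix_def mat_of_rows_list_def scalar_prod_def eval_nat_numeral algebra_simps)
  have J1: "2 * vec_index v 2 = of_real C1 * \<mu> * vec_index v 0" and J2: "2 * vec_index v 3 = of_real C2 * \<mu> * vec_index v 1"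
    using e0 e1 C by (simp_all add: field_simps)
  \<comment> \<open>By \<open>J1\<close> and \<open>J2\<close> the momenta are multiples of the
    angle components, also when \<open>\<mu> = 0\<close>, so an eigenvector with both angle
    components zero would vanish.\<close>
  have "vec_index v 0 \<noteq> 0 \<or> vec_index v 1 \<noteq> 0"
  proof (rule ccontr)
    assume "\<not> ?thesis"
    with J1 J2 have "vec_index v i = 0" if "i < 4" for i
      using that by (auto simp: eval_nat_numeral less_Suc_eq)
    with v show False by (auto intro: eq_vecI)
  qed
  moreover have "\<mu>\<^sup>2 * of_real C1 * vec_index v 0
      = - 2 * (of_real (K1 + K2 + 2 * K3 + K4 + K5) * vec_index v 0 + of_real (K4 - K5) * vec_index v 1)"
  proof -
    have "\<mu>\<^sup>2 * of_real C1 * vec_index v 0 = 2 * (\<mu> * vec_index v 2)"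
      using J1[symmetric] by (simp add: power2_eq_square mult_ac)
    then show ?thesis unfolding e2[symmetric] by (simp add: algebra_simps)
  qed
  moreover have "\<mu>\<^sup>2 * of_real C2 * vec_index v 1
      = - 2 * (of_real (L4 - L5) * vec_index v 0 + of_real (L1 + L2 + 2 * L3 + L4 + L5) * vec_index v 1)"
  proof -
    have "\<mu>\<^sup>2 * of_real C2 * vec_index v 1 = 2 * (\<mu> * vec_index v 3)"
      using J2[symmetric] by (simp add: power2_eq_square mult_ac)
    then show ?thesis unfolding e3[symmetric] by (simp add: algebra_simps)
  qed
  ultimately show ?thesis by (rule that)
qed

lemma Re_eq_0_if_square_nonpos:
  assumes "z\<^sup>2 = - complex_of_real s" and "s \<ge> 0"
  shows "Re z = 0"
proof -
  have sq: "(Re z)\<^sup>2 - (Im z)\<^sup>2 = - s" and "2 * Re z * Im z = 0"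
    using arg_cong[OF assms(1), of Re] arg_cong[OF assms(1), of Im]
    by (simp_all add: Re_power2 Im_power2)
  then consider "Re z = 0" | "Im z = 0" by auto
  then show ?thesis
  proof cases
    \<comment> \<open>Here the real-part equation reads \<open>(Re z)^2 = - s\<close>.\<close>
    case 2
    with sq \<open>s \<ge> 0\<close> have "(Re z)\<^sup>2 \<le> 0" by simp
    then show ?thesis by simp
  qed
qed

text \<open>Repeating \<open>K4 K5\<close> in both rows builds in the symmetry of \<open>S\<close>;
  \<open>s\<close> is twice the Rayleigh quotient of \<open>S\<close> relative to \<open>C\<close>.
  The strict clause serves to exclude a zero eigenvalue.\<close>

lemma linearized_matrix_eigenvalue_square:
  assumes ev: "eigenvalue (map_mat complex_of_real
      (linearized_matrix C1 C2 K1 K2 K3 K4 K5 L1 L2 L3 K4 K5)) \<mu>"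
    and C: "C1 > 0" "C2 > 0"
    and nonneg: "K1 + K2 + 2 * K3 \<ge> 0" "L1 + L2 + 2 * L3 \<ge> 0" "K4 \<ge> 0" "K5 \<ge> 0"
  obtains s where "\<mu>\<^sup>2 = - complex_of_real s" and "s \<ge> 0"
    and "K1 + K2 + 2 * K3 > 0 \<Longrightarrow> L1 + L2 + 2 * L3 > 0 \<Longrightarrow> s > 0"
proof -
  define k l where kl: "k = K1 + K2 + 2 * K3" "l = L1 + L2 + 2 * L3"
  obtain x y where xy: "x \<noteq> 0 \<or> y \<noteq> 0"
    and x: "\<mu>\<^sup>2 * of_real C1 * x = - 2 * (of_real (k + K4 + K5) * x + of_real (K4 - K5) * y)"
    and y: "\<mu>\<^sup>2 * of_real C2 * y = - 2 * (of_real (K4 - K5) * x + of_real (l + K4 + K5) * y)"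
    using linearized_matrix_eigenvalueE[OF ev] C unfolding kl by (metis less_irrefl)
  \<comment> \<open>\<open>n\<close> and \<open>w\<close> are the Hermitian forms of
    \<open>C\<close> and \<open>S\<close> at \<open>(x, y)\<close>.\<close>
  define n where "n = C1 * (cmod x)\<^sup>2 + C2 * (cmod y)\<^sup>2"
  define w where "w = k * (cmod x)\<^sup>2 + l * (cmod y)\<^sup>2
      + K4 * (cmod (x + y))\<^sup>2 + K5 * (cmod (x - y))\<^sup>2"
  have n: "n > 0"
    using xy C by (auto simp: n_def add_pos_nonneg add_nonneg_pos)
  \<comment> \<open>Multiply the two equations by \<open>cnj x\<close> and \<open>cnj y\<close> and
    add. The mixed terms combine with the diagonal \<open>K4\<close> and \<open>K5\<close> into the
    squared moduli of \<open>x + y\<close> and \<open>x - y\<close>.\<close>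
  have "\<mu>\<^sup>2 * of_real n = \<mu>\<^sup>2 * of_real C1 * x * cnj x + \<mu>\<^sup>2 * of_real C2 * y * cnj y"
    unfolding n_def by (simp add: complex_norm_square algebra_simps del: of_real_power)
  also have "\<dots> = - 2 * of_real w"
    unfolding x y w_def by (simp add: complex_norm_square algebra_simps del: of_real_power)
  finally have "\<mu>\<^sup>2 = - complex_of_real (2 * w / n)"
    using n by (simp add: field_simps)
  moreover have "2 * w / n \<ge> 0"
    using n nonneg by (simp add: w_def kl)
  moreover have "2 * w / n > 0" if "k > 0" "l > 0"
  proof -
    \<comment> \<open>The diagonal part alone is already positive definite; the coupling terms can
      only add to it.\<close>
    have "k * (cmod x)\<^sup>2 + l * (cmod y)\<^sup>2 > 0"
      using xy that by (auto simp: add_pos_nonneg add_nonneg_pos)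
    with nonneg have "w > 0"
      unfolding w_def by (simp add: add_pos_nonneg)
    with n show ?thesis by simp
  qed
  ultimately show ?thesis using that unfolding kl by blast
qed

text \<open>Nonvanishing is claimed only for \<open>d1, d2 > 0\<close>: if some \<open>d_j\<close>
  is zero, every coefficient in its momentum row vanishes, the matrix is singular and 0 is an
  eigenvalue.\<close>

theorem proposition5:
  fixes a e G M1 M2 A1 B1 C1 A2 B2 C2 d1 d2 q1 q2 :: real
    and K1 K2 K3 K4 K5 L1 L2 L3 L4 L5 :: real
  assumes "a > 0" and "0 \<le> e" and "M1 > 0" and "M2 > 0"
    and "0 < A1" and "A1 \<le> B1" and "B1 \<le> C1"
    and "0 < A2" and "A2 \<le> B2" and "B2 \<le> C2"
    and "M1 + M2 = 1" and "C1 + C2 = 1" and "G = a ^ 3"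
    and "d1 = B1 - A1" and "d2 = B2 - A2"
    and "q1 = 2 * C1 - B1 - A1" and "q2 = 2 * C2 - B2 - A2"
    and "K1 = 3 * d1 * G * M2 / (2 * a ^ 3) * (1 - 5 / 2 * e ^ 2)"
    and "L1 = 3 * d2 * G * M1 / (2 * a ^ 3) * (1 - 5 / 2 * e ^ 2)"
    and "K2 = (75 * d1 * G * M2 * q1 / (56 * a ^ 5 * M1) + 15 * d1 * G * q2 / (8 * a ^ 5)) * (1 + e ^ 2)"
    and "L2 = (75 * d2 * G * M1 * q2 / (56 * a ^ 5 * M2) + 15 * d2 * G * q1 / (8 * a ^ 5)) * (1 + e ^ 2)"
    and "K3 = 75 * d1 ^ 2 * G * M2 / (16 * a ^ 5 * M1) * (1 - 11 * e ^ 2)"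
    and "L3 = 75 * d2 ^ 2 * G * M1 / (16 * a ^ 5 * M2) * (1 - 11 * e ^ 2)"
    and "K4 = 105 * d1 * d2 * G / (16 * a ^ 5) * (1 - 11 * e ^ 2)"
    and "L4 = 105 * d1 * d2 * G / (16 * a ^ 5) * (1 - 11 * e ^ 2)"
    and "K5 = 9 * d1 * d2 * G / (16 * a ^ 5) + 45 * d1 * d2 * e ^ 2 * G / (16 * a ^ 5)"
    and "L5 = 9 * d1 * d2 * G / (16 * a ^ 5) + 45 * d1 * d2 * e ^ 2 * G / (16 * a ^ 5)"
    and "e < 1 / sqrt 11"
  shows "\<forall>\<mu>. eigenvalue (map_mat complex_of_real
             (linearized_matrix C1 C2 K1 K2 K3 K4 K5 L1 L2 L3 L4 L5)) \<mu> \<longrightarrow>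
           Re \<mu> = 0 \<and> (d1 > 0 \<and> d2 > 0 \<longrightarrow> \<mu> \<noteq> 0)"
proof (intro allI impI)
  fix \<mu>
  assume ev: "eigenvalue (map_mat complex_of_real
    (linearized_matrix C1 C2 K1 K2 K3 K4 K5 L1 L2 L3 L4 L5)) \<mu>"
  have "e\<^sup>2 < (1 / sqrt 11)\<^sup>2"
    using \<open>0 \<le> e\<close> \<open>e < 1 / sqrt 11\<close> by (intro power_strict_mono) auto
  then have e: "11 * e\<^sup>2 < 1" by (simp add: power_divide)
  \<comment> \<open>Each \<open>q\<close> is the sum of \<open>C - B\<close> and
    \<open>C - A\<close>, and \<open>C > 0\<close> follows from
    \<open>0 < A \<le> B \<le> C\<close>.\<close>
  have d: "d1 \<ge> 0" "d2 \<ge> 0" and q: "q1 \<ge> 0" "q2 \<ge> 0" and C: "C1 > 0" "C2 > 0" and G: "G > 0"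
    using assms by simp_all
  \<comment> \<open>Since 1/11 < 2/5, the factor \<open>1 - 5 / 2 * e ^ 2\<close> is positive. The
    strict signs of \<open>K1\<close> and \<open>L1\<close> later give \<open>s > 0\<close>.\<close>
  have K1: "K1 \<ge> 0" "L1 \<ge> 0" "d1 > 0 \<Longrightarrow> K1 > 0" "d2 > 0 \<Longrightarrow> L1 > 0"
    using e d G \<open>a > 0\<close> \<open>M1 > 0\<close> \<open>M2 > 0\<close>
    unfolding \<open>K1 = _\<close> \<open>L1 = _\<close> by (simp_all add: zero_le_mult_iff)
  have K2: "K2 \<ge> 0" "L2 \<ge> 0"
    using d q G \<open>a > 0\<close> \<open>M1 > 0\<close> \<open>M2 > 0\<close> unfolding \<open>K2 = _\<close> \<open>L2 = _\<close> by simp_all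
  have K3: "K3 \<ge> 0" "L3 \<ge> 0"
    using e G \<open>a > 0\<close> \<open>M1 > 0\<close> \<open>M2 > 0\<close> unfolding \<open>K3 = _\<close> \<open>L3 = _\<close> by simp_all
  have K4: "K4 \<ge> 0" "K5 \<ge> 0"
    using e d G \<open>a > 0\<close> unfolding \<open>K4 = _\<close> \<open>K5 = _\<close> by simp_all
  have "L4 = K4" "L5 = K5" using assms by simp_all
  then obtain s where s: "\<mu>\<^sup>2 = - complex_of_real s" "s \<ge> 0"
      "K1 + K2 + 2 * K3 > 0 \<Longrightarrow> L1 + L2 + 2 * L3 > 0 \<Longrightarrow> s > 0"
    using linearized_matrix_eigenvalue_square[of C1 C2 K1 K2 K3 K4 K5 L1 L2 L3 \<mu>] ev C K1 K2 K3 K4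
    by (auto simp: add_nonneg_nonneg)
  have "Re \<mu> = 0" using s(1,2) by (rule Re_eq_0_if_square_nonpos)
  moreover have "\<mu> \<noteq> 0" if "d1 > 0" "d2 > 0"
    using s(1,3) K1(3,4) that K2 K3 by fastforce
  ultimately show "Re \<mu> = 0 \<and> (d1 > 0 \<and> d2 > 0 \<longrightarrow> \<mu> \<noteq> 0)" by blast
qed

end
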